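(* Let $\mathcal{E}$ be a cartesian closed category with a local state classifier $\{\xi_X\colon X\to\Xi\}_{X\in\mathrm{ob}(\mathcal{E})}$. Then the normalization operator $\xi_\Xi\colon\Xi\to\Xi$ (the component of the colimit cocone at the object $\Xi$) satisfies $$\mathrm{id}_\Xi\le\xi_\Xi$$ with respect to the canonical $\wedge$-semilattice structure on $\mathcal{E}(\Xi,\Xi)$.
   Context: Local state classifier: let $\mathcal{E}_{\mathrm{mono}}$ be the category with the same objects as $\mathcal{E}$ and with the monomorphisms of $\mathcal{E}$ as morphisms. A local state classifier of $\mathcal{E}$ is a (possibly large) colimit of the inclusion functor $\mathcal{E}_{\mathrm{mono}}\to\mathcal{E}$, i.e. an object $\Xi$ with a family $\{\xi_X\colon X\to\Xi\}_{X\in\mathrm{ob}(\mathcal{E})}$ such that $\xi_Y\circ m=\xi_X$ for every monomorphism $m\colon X\rightarrowtail Y$, and which is universal among such families: for every object $L$ and family $\{\phi_X\colon X\to L\}_X$ with $\phi_Y\circ m=\phi_X$ for all monomorphisms $m\colon X\rightarrowtail Y$, there is a unique $u\colon\Xi\to L$ with $u\circ\xi_X=\phi_X$ for all $X$. Order structure (known): since $\mathcal{E}$ is cartesian closed, there is a unique internal $\wedge$-semilattice structure (with top) on $\Xi$ such that, for all objects $X_1,\dots,X_n$ ($n\ge0$), the composite of $\xi_{X_1}\times\cdots\times\xi_{X_n}\colon X_1\times\cdots\times X_n\to\Xi^n$ with the $n$-ary meet $\wedge\colon\Xi^n\to\Xi$ equals $\xi_{X_1\times\cdots\times X_n}$.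 Hence every hom-set $\mathcal{E}(X,\Xi)$ is a $\wedge$-semilattice, ordered by $f\le g\iff f\wedge g=f$, where $f\wedge g$ is the composite $X\xrightarrow{\langle f,g\rangle}\Xi\times\Xi\xrightarrow{\wedge}\Xi$. *)

theory Defs
  imports Main
begin

section \<open>Categories\<close>

text \<open>Objects and morphisms are carrier sets inside arbitrary types, with no smallness
  condition. \<open>Comp E g f\<close> is \<open>g\<close> after \<open>f\<close>; the operations are
  unspecified outside the carriers and on non-composable pairs.\<close>

record ('o, 'm) category =
  Obj :: "'o set"
  Mor :: "'m set"
  Dom :: "'m \<Rightarrow> 'o"
  Cod :: "'m \<Rightarrow> 'o"
  Ident :: "'o \<Rightarrow> 'm"
  Comp :: "'m \<Rightarrow> 'm \<Rightarrow> 'm"  (infixl "\<cdot>\<index>" 70)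

definition Hom :: "('o, 'm, 'z) category_scheme \<Rightarrow> 'o \<Rightarrow> 'o \<Rightarrow> 'm set" where
  "Hom E X Y = {f \<in> Mor E. Dom E f = X \<and> Cod E f = Y}"

locale category =
  fixes E :: "('o, 'm, 'z) category_scheme" (structure)
  assumes Dom_closed: "f \<in> Mor E \<Longrightarrow> Dom E f \<in> Obj E"
    and Cod_closed: "f \<in> Mor E \<Longrightarrow> Cod E f \<in> Obj E"
    and Ident_closed: "X \<in> Obj E \<Longrightarrow> Ident E X \<in> Hom E X X"
    and Comp_closed: "f \<in> Hom E X Y \<Longrightarrow> g \<in> Hom E Y Z \<Longrightarrow> g \<cdot> f \<in> Hom E X Z"
    and Comp_Ident: "f \<in> Hom E X Y \<Longrightarrow> f \<cdot> Ident E X = f"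
    and Ident_Comp: "f \<in> Hom E X Y \<Longrightarrow> Ident E Y \<cdot> f = f"
    and Comp_assoc: "f \<in> Hom E W X \<Longrightarrow> g \<in> Hom E X Y \<Longrightarrow> h \<in> Hom E Y Z \<Longrightarrow>
      (h \<cdot> g) \<cdot> f = h \<cdot> (g \<cdot> f)"

definition mono_in :: "('o, 'm, 'z) category_scheme \<Rightarrow> 'm \<Rightarrow> bool" where
  "mono_in E m \<longleftrightarrow> m \<in> Mor E \<and>
    (\<forall>W \<in> Obj E. \<forall>f \<in> Hom E W (Dom E m). \<forall>g \<in> Hom E W (Dom E m).
      m \<cdot>\<^bsub>E\<^esub> f = m \<cdot>\<^bsub>E\<^esub> g \<longrightarrow> f = g)"

definition is_terminal :: "('o, 'm, 'z) category_scheme \<Rightarrow> 'o \<Rightarrow> bool" where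
  "is_terminal E T \<longleftrightarrow> T \<in> Obj E \<and> (\<forall>X \<in> Obj E. \<exists>!f. f \<in> Hom E X T)"

definition is_product ::
    "('o, 'm, 'z) category_scheme \<Rightarrow> 'o \<Rightarrow> 'o \<Rightarrow> 'o \<Rightarrow> 'm \<Rightarrow> 'm \<Rightarrow> bool" where
  "is_product E X Y P p q \<longleftrightarrow> P \<in> Obj E \<and> p \<in> Hom E P X \<and> q \<in> Hom E P Y \<and>
    (\<forall>Z \<in> Obj E. \<forall>f \<in> Hom E Z X. \<forall>g \<in> Hom E Z Y.
      \<exists>!h. h \<in> Hom E Z P \<and> p \<cdot>\<^bsub>E\<^esub> h = f \<and> q \<cdot>\<^bsub>E\<^esub> h = g)"

section \<open>Cartesian closed categories\<close>

text \<open>Finite products are chosen, so that the structure on \<open>\<Xi>\<close> below can be given by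
  morphisms on \<open>Prod E \<Xi> \<Xi>\<close>.\<close>

record ('o, 'm) fp_category = "('o, 'm) category" +
  One :: "'o"
  Prod :: "'o \<Rightarrow> 'o \<Rightarrow> 'o"
  Proj1 :: "'o \<Rightarrow> 'o \<Rightarrow> 'm"
  Proj2 :: "'o \<Rightarrow> 'o \<Rightarrow> 'm"

definition bang :: "('o, 'm, 'z) fp_category_scheme \<Rightarrow> 'o \<Rightarrow> 'm" where
  "bang E X = (THE f. f \<in> Hom E X (One E))"

definition pairing :: "('o, 'm, 'z) fp_category_scheme \<Rightarrow> 'm \<Rightarrow> 'm \<Rightarrow> 'm" where
  "pairing E f g = (THE h. h \<in> Hom E (Dom E f) (Prod E (Cod E f) (Cod E g)) \<and>
     Proj1 E (Cod E f) (Cod E g) \<cdot>\<^bsub>E\<^esub> h = f \<and> Proj2 E (Cod E f) (Cod E g) \<cdot>\<^bsub>E\<^esub> h = g)"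

definition prod_map :: "('o, 'm, 'z) fp_category_scheme \<Rightarrow> 'm \<Rightarrow> 'm \<Rightarrow> 'm" where
  "prod_map E f g = pairing E (f \<cdot>\<^bsub>E\<^esub> Proj1 E (Dom E f) (Dom E g))
                              (g \<cdot>\<^bsub>E\<^esub> Proj2 E (Dom E f) (Dom E g))"

definition is_exponential ::
    "('o, 'm, 'z) fp_category_scheme \<Rightarrow> 'o \<Rightarrow> 'o \<Rightarrow> 'o \<Rightarrow> 'm \<Rightarrow> bool" where
  "is_exponential E Y Z P ev \<longleftrightarrow> P \<in> Obj E \<and> ev \<in> Hom E (Prod E P Y) Z \<and>
    (\<forall>X \<in> Obj E. \<forall>f \<in> Hom E (Prod E X Y) Z.
      \<exists>!h. h \<in> Hom E X P \<and> ev \<cdot>\<^bsub>E\<^esub> prod_map E h (Ident E Y) = f)"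

locale cartesian_closed_category = category E
  for E :: "('o, 'm, 'z) fp_category_scheme" (structure) +
  assumes One_terminal: "is_terminal E (One E)"
    and Prod_product: "X \<in> Obj E \<Longrightarrow> Y \<in> Obj E \<Longrightarrow>
      is_product E X Y (Prod E X Y) (Proj1 E X Y) (Proj2 E X Y)"
    and exponential_exists: "Y \<in> Obj E \<Longrightarrow> Z \<in> Obj E \<Longrightarrow>
      \<exists>P ev. is_exponential E Y Z P ev"

section \<open>Local state classifiers\<close>

text \<open>A cocone under the inclusion of the subcategory of monomorphisms.\<close>

definition mono_cocone ::
    "('o, 'm, 'z) category_scheme \<Rightarrow> 'o \<Rightarrow> ('o \<Rightarrow> 'm) \<Rightarrow> bool" where
  "mono_cocone E L \<phi> \<longleftrightarrow> L \<in> Obj E \<and> (\<forall>X \<in> Obj E. \<phi> X \<in> Hom E X L) \<and>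
    (\<forall>m. mono_in E m \<longrightarrow> \<phi> (Cod E m) \<cdot>\<^bsub>E\<^esub> m = \<phi> (Dom E m))"

definition local_state_classifier ::
    "('o, 'm, 'z) category_scheme \<Rightarrow> 'o \<Rightarrow> ('o \<Rightarrow> 'm) \<Rightarrow> bool" where
  "local_state_classifier E \<Xi> \<xi> \<longleftrightarrow> mono_cocone E \<Xi> \<xi> \<and>
    (\<forall>L \<phi>. mono_cocone E L \<phi> \<longrightarrow>
      (\<exists>!u. u \<in> Hom E \<Xi> L \<and> (\<forall>X \<in> Obj E. u \<cdot>\<^bsub>E\<^esub> \<xi> X = \<phi> X)))"

section \<open>The canonical semilattice structure\<close>

definition internal_meet_semilattice ::
    "('o, 'm, 'z) fp_category_scheme \<Rightarrow> 'o \<Rightarrow> 'm \<Rightarrow> 'm \<Rightarrow> bool" where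
  "internal_meet_semilattice E A t m \<longleftrightarrow>
    A \<in> Obj E \<and> t \<in> Hom E (One E) A \<and> m \<in> Hom E (Prod E A A) A \<and>
    (let p = Proj1 E A A; q = Proj2 E A A;
         p' = Proj1 E (Prod E A A) A; q' = Proj2 E (Prod E A A) A;
         assoc = pairing E (p \<cdot>\<^bsub>E\<^esub> p') (pairing E (q \<cdot>\<^bsub>E\<^esub> p') q')
     in m \<cdot>\<^bsub>E\<^esub> prod_map E m (Ident E A) =
          m \<cdot>\<^bsub>E\<^esub> (prod_map E (Ident E A) m \<cdot>\<^bsub>E\<^esub> assoc) \<and>
        m \<cdot>\<^bsub>E\<^esub> pairing E q p = m \<and>
        m \<cdot>\<^bsub>E\<^esub> pairing E (Ident E A) (Ident E A) = Ident E A \<and>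
        m \<cdot>\<^bsub>E\<^esub> pairing E (Ident E A) (t \<cdot>\<^bsub>E\<^esub> bang E A) = Ident E A)"

text \<open>Finite products of lists are nested to the right and end in the terminal object:
  \<open>X\<^sub>1 \<times> (X\<^sub>2 \<times> (\<dots> \<times> 1))\<close>. Accordingly \<open>nary_meet E A t m n\<close> is a morphism from
  \<open>list_prod E (replicate n A)\<close> to \<open>A\<close>.\<close>

primrec list_prod :: "('o, 'm, 'z) fp_category_scheme \<Rightarrow> 'o list \<Rightarrow> 'o" where
  "list_prod E [] = One E"
| "list_prod E (X # Xs) = Prod E X (list_prod E Xs)"

primrec list_prod_map :: "('o, 'm, 'z) fp_category_scheme \<Rightarrow> 'm list \<Rightarrow> 'm" where
  "list_prod_map E [] = Ident E (One E)"
| "list_prod_map E (f # fs) = prod_map E f (list_prod_map E fs)"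

primrec nary_meet ::
    "('o, 'm, 'z) fp_category_scheme \<Rightarrow> 'o \<Rightarrow> 'm \<Rightarrow> 'm \<Rightarrow> nat \<Rightarrow> 'm" where
  "nary_meet E A t m 0 = t"
| "nary_meet E A t m (Suc n) =
    m \<cdot>\<^bsub>E\<^esub> prod_map E (Ident E A) (nary_meet E A t m n)"

definition is_canonical_structure ::
    "('o, 'm, 'z) fp_category_scheme \<Rightarrow> 'o \<Rightarrow> ('o \<Rightarrow> 'm) \<Rightarrow> 'm \<times> 'm \<Rightarrow> bool" where
  "is_canonical_structure E \<Xi> \<xi> = (\<lambda>(t, m).
    internal_meet_semilattice E \<Xi> t m \<and>
    (\<forall>Xs. set Xs \<subseteq> Obj E \<longrightarrow>
      nary_meet E \<Xi> t m (length Xs) \<cdot>\<^bsub>E\<^esub> list_prod_map E (map \<xi> Xs) =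
        \<xi> (list_prod E Xs)))"

text \<open>The description is proper: in a cartesian closed category with local state classifier
  \<open>(\<Xi>, \<xi>)\<close> exactly one pair (t, m) satisfies \<open>is_canonical_structure E \<Xi> \<xi>\<close>.\<close>

definition canonical_structure ::
    "('o, 'm, 'z) fp_category_scheme \<Rightarrow> 'o \<Rightarrow> ('o \<Rightarrow> 'm) \<Rightarrow> 'm \<times> 'm" where
  "canonical_structure E \<Xi> \<xi> = (THE s. is_canonical_structure E \<Xi> \<xi> s)"

definition hom_meet ::
    "('o, 'm, 'z) fp_category_scheme \<Rightarrow> 'o \<Rightarrow> ('o \<Rightarrow> 'm) \<Rightarrow> 'm \<Rightarrow> 'm \<Rightarrow> 'm" where
  "hom_meet E \<Xi> \<xi> f g = snd (canonical_structure E \<Xi> \<xi>) \<cdot>\<^bsub>E\<^esub> pairing E f g"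

definition hom_le ::
    "('o, 'm, 'z) fp_category_scheme \<Rightarrow> 'o \<Rightarrow> ('o \<Rightarrow> 'm) \<Rightarrow> 'm \<Rightarrow> 'm \<Rightarrow> bool" where
  "hom_le E \<Xi> \<xi> f g \<longleftrightarrow> hom_meet E \<Xi> \<xi> f g = f"

end

theory Submission
  imports Defs
begin

text \<open>Because \<open>- \<times> Y\<close> has a right adjoint, the maps \<open>\<xi>\<^sub>X \<times> \<xi>\<^sub>Y\<close> exhibit \<open>\<Xi> \<times> \<Xi>\<close> as a colimit, so
  there is exactly one \<open>m\<close> with \<open>m \<circ> (\<xi>\<^sub>X \<times> \<xi>\<^sub>Y) = \<xi>\<^sub>X\<^sub>\<times>\<^sub>Y\<close>. Each semilattice law becomes, after
  composition with the \<open>\<xi>\<close>'s, the invariance of \<open>\<xi>\<close> under a canonical monomorphism between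
  products. In the same way
  \<open>m \<circ> \<langle>id, \<xi>\<^sub>\<Xi>\<rangle> \<circ> \<xi>\<^sub>X = m \<circ> (\<xi>\<^sub>X \<times> \<xi>\<^sub>\<Xi>) \<circ> \<langle>id, \<xi>\<^sub>X\<rangle> = \<xi>\<^sub>X\<^sub>\<times>\<^sub>\<Xi> \<circ> \<langle>id, \<xi>\<^sub>X\<rangle> = \<xi>\<^sub>X\<close>,
  since \<open>\<langle>id, \<xi>\<^sub>X\<rangle>\<close> is a split monomorphism.\<close>

section \<open>Calculus of finite products\<close>

text \<open>The rules are stated with \<open>Dom\<close> and \<open>Cod\<close> rather than with \<open>Hom\<close>, so that their premises
  contain no variables that the simplifier would have to guess.\<close>

context category
begin

lemma Ident_simps [simp]:
  assumes "X \<in> Obj E"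
  shows "Ident E X \<in> Mor E" "Dom E (Ident E X) = X" "Cod E (Ident E X) = X"
  using Ident_closed[OF assms] by (auto simp: Hom_def)

lemma Comp_simps [simp]:
  assumes "f \<in> Mor E" "g \<in> Mor E" "Dom E g = Cod E f"
  shows "g \<cdot> f \<in> Mor E" "Dom E (g \<cdot> f) = Dom E f" "Cod E (g \<cdot> f) = Cod E g"
  using Comp_closed[of f "Dom E f" "Cod E f" g "Cod E g"] assms by (auto simp: Hom_def)

lemma Comp_Ident_simp [simp]: "f \<in> Mor E \<Longrightarrow> Dom E f = X \<Longrightarrow> f \<cdot> Ident E X = f"
  using Comp_Ident[of f X "Cod E f"] by (auto simp: Hom_def)

lemma Ident_Comp_simp [simp]: "f \<in> Mor E \<Longrightarrow> Cod E f = Y \<Longrightarrow> Ident E Y \<cdot> f = f"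
  using Ident_Comp[of f "Dom E f" Y] by (auto simp: Hom_def)

lemma Comp_assoc_simp [simp]:
  assumes "f \<in> Mor E" "g \<in> Mor E" "h \<in> Mor E" "Dom E g = Cod E f" "Dom E h = Cod E g"
  shows "(h \<cdot> g) \<cdot> f = h \<cdot> (g \<cdot> f)"
  using Comp_assoc[of f "Dom E f" "Cod E f" g "Cod E g" h "Cod E h"] assms
  by (auto simp: Hom_def)

text \<open>Simplification nests composites to the right, which hides a subterm
  \<open>h \<cdot> g\<close> inside \<open>h \<cdot> (g \<cdot> f)\<close>. Instantiated with a
  known equation, this rule rewrites it there.\<close>

lemma Comp_eq_reassoc:
  assumes "h \<cdot> g = k"
    "f \<in> Mor E" "g \<in> Mor E" "h \<in> Mor E" "Dom E g = Cod E f" "Dom E h = Cod E g"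
  shows "h \<cdot> (g \<cdot> f) = k \<cdot> f"
  using Comp_assoc_simp[OF assms(2-6)] assms(1) by simp

lemmas Obj_simps [simp] = Dom_closed Cod_closed

lemma mono_inI:
  assumes "m \<in> Mor E" "\<And>f g. f \<in> Mor E \<Longrightarrow> g \<in> Mor E \<Longrightarrow> Dom E f = Dom E g \<Longrightarrow>
    Cod E f = Dom E m \<Longrightarrow> Cod E g = Dom E m \<Longrightarrow> m \<cdot> f = m \<cdot> g \<Longrightarrow> f = g"
  shows "mono_in E m"
  using assms unfolding mono_in_def Hom_def by blast

lemma mono_in_Mor: "mono_in E m \<Longrightarrow> m \<in> Mor E"
  by (simp add: mono_in_def)

lemma mono_in_cancel:
  assumes "mono_in E m" "f \<in> Mor E" "g \<in> Mor E" "Dom E f = Dom E g"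
    "Cod E f = Dom E m" "Cod E g = Dom E m" "m \<cdot> f = m \<cdot> g"
  shows "f = g"
proof -
  have "f \<in> Hom E (Dom E g) (Dom E m)" "g \<in> Hom E (Dom E g) (Dom E m)" "Dom E g \<in> Obj E"
    using assms by (simp_all add: Hom_def)
  with assms(1,7) show ?thesis unfolding mono_in_def by blast
qed

text \<open>The retraction \<open>r\<close> cancels \<open>f\<close>. Graphs and rearrangements of
  products are recognized as monomorphisms in this way.\<close>

lemma split_mono:
  assumes "f \<in> Mor E" "r \<in> Mor E" "Dom E r = Cod E f" "r \<cdot> f = Ident E (Dom E f)"
  shows "mono_in E f"
proof (rule mono_inI[OF assms(1)])
  fix g h
  assume gh: "g \<in> Mor E" "h \<in> Mor E" "Dom E g = Dom E h" "Cod E g = Dom E f" "Cod E h = Dom E f"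
    and eq: "f \<cdot> g = f \<cdot> h"
  have "r \<cdot> (f \<cdot> g) = g" "r \<cdot> (f \<cdot> h) = h"
    using gh assms by (simp_all add: Comp_eq_reassoc[OF assms(4)])
  with eq show "g = h" by metis
qed

end

section \<open>Terminal object, binary products and their symmetry\<close>

context cartesian_closed_category
begin

lemma One_Obj [simp]: "One E \<in> Obj E"
  using One_terminal by (simp add: is_terminal_def)

lemma Proj_simps [simp]:
  assumes "X \<in> Obj E" "Y \<in> Obj E"
  shows "Prod E X Y \<in> Obj E"
    "Proj1 E X Y \<in> Mor E" "Dom E (Proj1 E X Y) = Prod E X Y" "Cod E (Proj1 E X Y) = X"
    "Proj2 E X Y \<in> Mor E" "Dom E (Proj2 E X Y) = Prod E X Y" "Cod E (Proj2 E X Y) = Y"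
  using Prod_product[OF assms] by (auto simp: is_product_def Hom_def)

lemma ex1_pairing:
  assumes "f \<in> Mor E" "g \<in> Mor E" "Dom E f = Dom E g"
  shows "\<exists>!h. h \<in> Hom E (Dom E f) (Prod E (Cod E f) (Cod E g)) \<and>
    Proj1 E (Cod E f) (Cod E g) \<cdot> h = f \<and> Proj2 E (Cod E f) (Cod E g) \<cdot> h = g"
  using Prod_product[of "Cod E f" "Cod E g"] assms
  by (simp add: is_product_def Hom_def)

lemma pairing_simps [simp]:
  assumes "f \<in> Mor E" "g \<in> Mor E" "Dom E f = Dom E g"
  shows "pairing E f g \<in> Mor E" "Dom E (pairing E f g) = Dom E f"
    "Cod E (pairing E f g) = Prod E (Cod E f) (Cod E g)"
  using theI'[OF ex1_pairing[OF assms]] by (simp_all add: pairing_def Hom_def)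

lemma Proj_pairing [simp]:
  assumes "f \<in> Mor E" "g \<in> Mor E" "Dom E f = Dom E g" "Cod E f = X" "Cod E g = Y"
  shows "Proj1 E X Y \<cdot> pairing E f g = f" "Proj2 E X Y \<cdot> pairing E f g = g"
  using theI'[OF ex1_pairing[OF assms(1-3)]] assms by (simp_all add: pairing_def)

text \<open>This is the uniqueness half of the universal property: \<open>h\<close> is determined by
  its two projections.\<close>

lemma pairing_Proj [simp]:
  assumes "X \<in> Obj E" "Y \<in> Obj E" "h \<in> Mor E" "Cod E h = Prod E X Y"
  shows "pairing E (Proj1 E X Y \<cdot> h) (Proj2 E X Y \<cdot> h) = h"
  using ex1_pairing[of "Proj1 E X Y \<cdot> h" "Proj2 E X Y \<cdot> h"] assms
  unfolding pairing_def by (intro the1_equality) (simp_all add: Hom_def)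

lemma pairing_Proj_Ident [simp]:
  assumes "X \<in> Obj E" "Y \<in> Obj E"
  shows "pairing E (Proj1 E X Y) (Proj2 E X Y) = Ident E (Prod E X Y)"
  using pairing_Proj[of X Y "Ident E (Prod E X Y)"] assms by simp

lemma pairing_Comp [simp]:
  assumes "f \<in> Mor E" "g \<in> Mor E" "Dom E f = Dom E g" "h \<in> Mor E" "Cod E h = Dom E f"
  shows "pairing E f g \<cdot> h = pairing E (f \<cdot> h) (g \<cdot> h)"
proof -
  let ?k = "pairing E f g \<cdot> h"
  have "Proj1 E (Cod E f) (Cod E g) \<cdot> ?k = f \<cdot> h" "Proj2 E (Cod E f) (Cod E g) \<cdot> ?k = g \<cdot> h"
    using assms by (simp_all add: Comp_eq_reassoc[OF Proj_pairing(1)]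
        Comp_eq_reassoc[OF Proj_pairing(2)])
  then show ?thesis
    using pairing_Proj[of "Cod E f" "Cod E g" ?k] assms by simp
qed

lemma prod_map_simps [simp]:
  assumes "f \<in> Mor E" "g \<in> Mor E"
  shows "prod_map E f g \<in> Mor E" "Dom E (prod_map E f g) = Prod E (Dom E f) (Dom E g)"
    "Cod E (prod_map E f g) = Prod E (Cod E f) (Cod E g)"
  using assms by (simp_all add: prod_map_def)

lemma prod_map_pairing [simp]:
  assumes "f \<in> Mor E" "g \<in> Mor E" "a \<in> Mor E" "b \<in> Mor E"
    "Dom E a = Dom E b" "Cod E a = Dom E f" "Cod E b = Dom E g"
  shows "prod_map E f g \<cdot> pairing E a b = pairing E (f \<cdot> a) (g \<cdot> b)"
  using assms by (simp add: prod_map_def)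

lemma prod_map_Comp [simp]:
  assumes "f \<in> Mor E" "g \<in> Mor E" "a \<in> Mor E" "b \<in> Mor E"
    "Cod E a = Dom E f" "Cod E b = Dom E g"
  shows "prod_map E f g \<cdot> prod_map E a b = prod_map E (f \<cdot> a) (g \<cdot> b)"
  using assms by (simp add: prod_map_def)

lemma bang_simps [simp]:
  assumes "X \<in> Obj E"
  shows "bang E X \<in> Mor E" "Dom E (bang E X) = X" "Cod E (bang E X) = One E"
proof -
  have "\<exists>!f. f \<in> Hom E X (One E)"
    using One_terminal assms by (simp add: is_terminal_def)
  then have "bang E X \<in> Hom E X (One E)"
    unfolding bang_def by (rule theI')
  then show "bang E X \<in> Mor E" "Dom E (bang E X) = X" "Cod E (bang E X) = One E"
    by (simp_all add: Hom_def)
qed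

lemma bang_unique:
  assumes "f \<in> Mor E" "Cod E f = One E"
  shows "f = bang E (Dom E f)"
proof -
  have "\<exists>!h. h \<in> Hom E (Dom E f) (One E)"
    using One_terminal assms by (simp add: is_terminal_def)
  then show ?thesis using assms by (auto simp: Hom_def)
qed

lemma bang_Comp [simp]: "f \<in> Mor E \<Longrightarrow> Cod E f = X \<Longrightarrow> bang E X \<cdot> f = bang E (Dom E f)"
  using bang_unique[of "bang E X \<cdot> f"] by auto

text \<open>Exponentials transpose only the left factor of a product; the symmetry carries the
  resulting facts over to the right factor.\<close>

definition swap :: "'o \<Rightarrow> 'o \<Rightarrow> 'm" where
  "swap X Y = pairing E (Proj2 E X Y) (Proj1 E X Y)"

lemma swap_simps [simp]:
  assumes "X \<in> Obj E" "Y \<in> Obj E"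
  shows "swap X Y \<in> Mor E" "Dom E (swap X Y) = Prod E X Y" "Cod E (swap X Y) = Prod E Y X"
    "swap X Y \<cdot> swap Y X = Ident E (Prod E Y X)"
  using assms by (simp_all add: swap_def)

lemma swap_prod_map:
  assumes "f \<in> Mor E" "g \<in> Mor E" "Cod E f = X" "Cod E g = Y"
  shows "swap X Y \<cdot> prod_map E f g = prod_map E g f \<cdot> swap (Dom E f) (Dom E g)"
  using assms by (auto simp add: swap_def prod_map_def)

text \<open>Projecting an equation between composites to each factor lets \<open>m\<close> and
  \<open>n\<close> be cancelled separately.\<close>

lemma mono_prod_map:
  assumes m: "mono_in E m" and n: "mono_in E n"
  shows "mono_in E (prod_map E m n)"
proof -
  note [simp] = mono_in_Mor[OF m] mono_in_Mor[OF n]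
  show ?thesis
  proof (rule mono_inI)
    fix f g
    assume fg: "f \<in> Mor E" "g \<in> Mor E" "Dom E f = Dom E g"
      "Cod E f = Dom E (prod_map E m n)" "Cod E g = Dom E (prod_map E m n)"
      and eq: "prod_map E m n \<cdot> f = prod_map E m n \<cdot> g"
    note [simp] = fg(1-3) fg(4,5)[simplified]
    let ?p = "Proj1 E (Dom E m) (Dom E n)" and ?q = "Proj2 E (Dom E m) (Dom E n)"
    have *: "pairing E (m \<cdot> (?p \<cdot> f)) (n \<cdot> (?q \<cdot> f)) = pairing E (m \<cdot> (?p \<cdot> g)) (n \<cdot> (?q \<cdot> g))"
      using eq by (simp add: prod_map_def)
    have "m \<cdot> (?p \<cdot> f) = m \<cdot> (?p \<cdot> g)"
      using arg_cong[OF *, of "\<lambda>k. Proj1 E (Cod E m) (Cod E n) \<cdot> k"] by simp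
    then have p: "?p \<cdot> f = ?p \<cdot> g"
      by (intro mono_in_cancel[OF m, of "?p \<cdot> f"]) simp_all
    have "n \<cdot> (?q \<cdot> f) = n \<cdot> (?q \<cdot> g)"
      using arg_cong[OF *, of "\<lambda>k. Proj2 E (Cod E m) (Cod E n) \<cdot> k"] by simp
    then have q: "?q \<cdot> f = ?q \<cdot> g"
      by (intro mono_in_cancel[OF n, of "?q \<cdot> f"]) simp_all
    have "f = pairing E (?p \<cdot> f) (?q \<cdot> f)" by simp
    also have "\<dots> = g" unfolding p q by simp
    finally show "f = g" .
  qed simp
qed

lemma mono_Ident: "X \<in> Obj E \<Longrightarrow> mono_in E (Ident E X)"
  by (rule split_mono[where r = "Ident E X"]) simp_all

section \<open>Products and jointly epic families\<close>

text \<open>Transposition is put as a bijection of hom-sets: surjectivity supplies transposes,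
  injectivity reduces equations between transposes to equations after evaluation.\<close>

lemma exponential:
  assumes [simp]: "Y \<in> Obj E" "Z \<in> Obj E"
  obtains P ev where "P \<in> Obj E" "ev \<in> Mor E" "Dom E ev = Prod E P Y" "Cod E ev = Z"
    "\<forall>X \<in> Obj E. bij_betw (\<lambda>h. ev \<cdot> prod_map E h (Ident E Y)) (Hom E X P) (Hom E (Prod E X Y) Z)"
proof -
  obtain P ev where *: "is_exponential E Y Z P ev"
    using exponential_exists assms by blast
  then have ev [simp]: "P \<in> Obj E" "ev \<in> Mor E" "Dom E ev = Prod E P Y" "Cod E ev = Z"
    and ex1: "\<And>X f. X \<in> Obj E \<Longrightarrow> f \<in> Hom E (Prod E X Y) Z \<Longrightarrow>
      \<exists>!h. h \<in> Hom E X P \<and> ev \<cdot> prod_map E h (Ident E Y) = f"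
    by (simp_all add: is_exponential_def Hom_def)
  have closed: "ev \<cdot> prod_map E h (Ident E Y) \<in> Hom E (Prod E X Y) Z" if "h \<in> Hom E X P" for X h
    using that by (auto simp: Hom_def)
  have "bij_betw (\<lambda>h. ev \<cdot> prod_map E h (Ident E Y)) (Hom E X P) (Hom E (Prod E X Y) Z)"
    if "X \<in> Obj E" for X
    unfolding bij_betw_def
  proof (intro conjI inj_onI equalityI subsetI)
    fix f assume "f \<in> Hom E (Prod E X Y) Z"
    from ex1[OF that this]
    show "f \<in> (\<lambda>h. ev \<cdot> prod_map E h (Ident E Y)) ` Hom E X P" by blast
  \<comment> \<open>Injectivity is the uniqueness of transposes, applied to the image of one of the
    two morphisms.\<close>
  qed (use ex1[OF that closed] closed in blast)+
  with ev show thesis by (intro that) blast+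
qed

section \<open>Jointly epic families and their products\<close>

definition jointly_epic :: "'o \<Rightarrow> 'm set \<Rightarrow> bool" where
  "jointly_epic A S \<longleftrightarrow> A \<in> Obj E \<and> (\<forall>s \<in> S. s \<in> Mor E \<and> Cod E s = A) \<and>
    (\<forall>f \<in> Mor E. \<forall>g \<in> Mor E. Dom E f = A \<longrightarrow> Dom E g = A \<longrightarrow> Cod E f = Cod E g \<longrightarrow>
      (\<forall>s \<in> S. f \<cdot> s = g \<cdot> s) \<longrightarrow> f = g)"

lemma jointly_epicI:
  assumes "A \<in> Obj E" "\<And>s. s \<in> S \<Longrightarrow> s \<in> Mor E \<and> Cod E s = A"
    "\<And>f g. f \<in> Mor E \<Longrightarrow> g \<in> Mor E \<Longrightarrow> Dom E f = A \<Longrightarrow> Dom E g = A \<Longrightarrow> Cod E f = Cod E g \<Longrightarrow>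
      (\<And>s. s \<in> S \<Longrightarrow> f \<cdot> s = g \<cdot> s) \<Longrightarrow> f = g"
  shows "jointly_epic A S"
  using assms unfolding jointly_epic_def by blast

lemma jointly_epicD:
  assumes "jointly_epic A S" "f \<in> Mor E" "g \<in> Mor E" "Dom E f = A" "Dom E g = A"
    "Cod E f = Cod E g" "\<And>s. s \<in> S \<Longrightarrow> f \<cdot> s = g \<cdot> s"
  shows "f = g"
  using assms unfolding jointly_epic_def by blast

text \<open>The functor \<open>- \<times> Y\<close> is a left adjoint: the transposes of
  \<open>f\<close> and \<open>g\<close> agree after every \<open>s\<close> in \<open>S\<close>,
  hence are equal, and so are \<open>f\<close> and \<open>g\<close>.\<close>

lemma jointly_epic_times_Ident:
  assumes S: "jointly_epic A S" and Y: "Y \<in> Obj E"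
  shows "jointly_epic (Prod E A Y) ((\<lambda>s. prod_map E s (Ident E Y)) ` S)"
proof -
  have A [simp]: "A \<in> Obj E" and S' [simp]: "\<And>s. s \<in> S \<Longrightarrow> s \<in> Mor E" "\<And>s. s \<in> S \<Longrightarrow> Cod E s = A"
    using S unfolding jointly_epic_def by blast+
  note [simp] = Y
  have *: "f = g" if fg [simp]: "f \<in> Mor E" "g \<in> Mor E" "Dom E f = Prod E A Y" "Dom E g = Prod E A Y"
    "Cod E f = Cod E g" and
    eq: "\<And>s. s \<in> S \<Longrightarrow> f \<cdot> prod_map E s (Ident E Y) = g \<cdot> prod_map E s (Ident E Y)" for f g
  proof -
    have Z: "Cod E g \<in> Obj E" by simp
    obtain P ev where ev [simp]: "P \<in> Obj E" "ev \<in> Mor E" "Dom E ev = Prod E P Y"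
      "Cod E ev = Cod E g"
      and curry: "\<forall>X \<in> Obj E. bij_betw (\<lambda>h. ev \<cdot> prod_map E h (Ident E Y))
        (Hom E X P) (Hom E (Prod E X Y) (Cod E g))"
      by (rule exponential[OF Y Z])
    have "f \<in> Hom E (Prod E A Y) (Cod E g)" "g \<in> Hom E (Prod E A Y) (Cod E g)"
      by (simp_all add: Hom_def)
    then have "f \<in> (\<lambda>h. ev \<cdot> prod_map E h (Ident E Y)) ` Hom E A P"
      "g \<in> (\<lambda>h. ev \<cdot> prod_map E h (Ident E Y)) ` Hom E A P"
      by (simp_all only: bij_betw_imp_surj_on[OF curry[rule_format, OF A]])
    then obtain h k where h: "h \<in> Hom E A P" "f = ev \<cdot> prod_map E h (Ident E Y)"
      and k: "k \<in> Hom E A P" "g = ev \<cdot> prod_map E k (Ident E Y)"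
      by blast
    have hk [simp]: "h \<in> Mor E" "k \<in> Mor E" "Dom E h = A" "Dom E k = A" "Cod E h = P" "Cod E k = P"
      using h(1) k(1) by (auto simp: Hom_def)
    have hk_S: "h \<cdot> s = k \<cdot> s" if s [simp]: "s \<in> S" for s
    proof -
      have "ev \<cdot> prod_map E (h \<cdot> s) (Ident E Y) = f \<cdot> prod_map E s (Ident E Y)"
        unfolding h(2) by simp
      moreover have "ev \<cdot> prod_map E (k \<cdot> s) (Ident E Y) = g \<cdot> prod_map E s (Ident E Y)"
        unfolding k(2) by simp
      ultimately have "ev \<cdot> prod_map E (h \<cdot> s) (Ident E Y) = ev \<cdot> prod_map E (k \<cdot> s) (Ident E Y)"
        by (simp only: eq[OF s])
      then show ?thesis
        by (rule inj_onD[OF bij_betw_imp_inj_on[OF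
              curry[rule_format, OF Dom_closed[OF S'(1)[OF s]]]]]) (simp_all add: Hom_def)
    qed
    have "h = k" by (rule jointly_epicD[OF S]) (simp_all add: hk_S)
    with h k show "f = g" by metis
  qed
  show ?thesis
  proof (rule jointly_epicI, goal_cases)
    case 2 then show ?case by auto
  next
    case 3 show ?case by (rule *) (use 3 in blast)+
  qed simp
qed

lemma jointly_epic_Ident_times:
  assumes S: "jointly_epic A S" and Y: "Y \<in> Obj E"
  shows "jointly_epic (Prod E Y A) ((\<lambda>s. prod_map E (Ident E Y) s) ` S)"
proof -
  have A [simp]: "A \<in> Obj E" and S' [simp]: "\<And>s. s \<in> S \<Longrightarrow> s \<in> Mor E" "\<And>s. s \<in> S \<Longrightarrow> Cod E s = A"
    using S unfolding jointly_epic_def by blast+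
  note [simp] = Y
  have *: "f = g" if fg [simp]: "f \<in> Mor E" "g \<in> Mor E" "Dom E f = Prod E Y A" "Dom E g = Prod E Y A"
    "Cod E f = Cod E g" and
    eq: "\<And>s. s \<in> S \<Longrightarrow> f \<cdot> prod_map E (Ident E Y) s = g \<cdot> prod_map E (Ident E Y) s" for f g
  proof -
    \<comment> \<open>Precomposing with the symmetry moves \<open>Y\<close> to the right, where the
      previous lemma applies; the inverse symmetry is cancelled at the end.\<close>
    have "f \<cdot> swap A Y = g \<cdot> swap A Y"
    proof (rule jointly_epicD[OF jointly_epic_times_Ident[OF S Y]])
      fix t assume "t \<in> (\<lambda>s. prod_map E s (Ident E Y)) ` S"
      then obtain s where s [simp]: "s \<in> S" and t: "t = prod_map E s (Ident E Y)" by blast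
      have "f \<cdot> (prod_map E (Ident E Y) s \<cdot> swap (Dom E s) Y) =
        g \<cdot> (prod_map E (Ident E Y) s \<cdot> swap (Dom E s) Y)"
        \<comment> \<open>Both sides are regrouped to the left to expose the composites that
          \<open>eq\<close> speaks of; the associativity rule is switched off so that it cannot undo
          this.\<close>
        by (subst (1 2) Comp_eq_reassoc[OF refl]) (simp_all add: eq[OF s] del: Comp_assoc_simp)
      then show "(f \<cdot> swap A Y) \<cdot> t = (g \<cdot> swap A Y) \<cdot> t"
        by (simp add: t swap_prod_map)
    qed simp_all
    then have "(f \<cdot> swap A Y) \<cdot> swap Y A = (g \<cdot> swap A Y) \<cdot> swap Y A" by simp
    then show "f = g" by simp
  qed
  show ?thesis
  proof (rule jointly_epicI, goal_cases)
    case 2 then show ?case by auto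
  next
    case 3 show ?case by (rule *) (use 3 in blast)+
  qed simp
qed

text \<open>Since \<open>s \<times> t = (s \<times> id) \<circ> (id \<times> t)\<close>, the two
  factors can be cancelled one after the other.\<close>

lemma jointly_epic_prod:
  assumes S: "jointly_epic A S" and T: "jointly_epic B T"
  shows "jointly_epic (Prod E A B) {prod_map E s t | s t. s \<in> S \<and> t \<in> T}"
proof -
  have A [simp]: "A \<in> Obj E" and S' [simp]: "\<And>s. s \<in> S \<Longrightarrow> s \<in> Mor E" "\<And>s. s \<in> S \<Longrightarrow> Cod E s = A"
    using S unfolding jointly_epic_def by blast+
  have B [simp]: "B \<in> Obj E" and T' [simp]: "\<And>s. s \<in> T \<Longrightarrow> s \<in> Mor E" "\<And>s. s \<in> T \<Longrightarrow> Cod E s = B"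
    using T unfolding jointly_epic_def by blast+
  have *: "f = g" if fg [simp]: "f \<in> Mor E" "g \<in> Mor E" "Dom E f = Prod E A B" "Dom E g = Prod E A B"
    "Cod E f = Cod E g" and
    eq: "\<And>s t. s \<in> S \<Longrightarrow> t \<in> T \<Longrightarrow> f \<cdot> prod_map E s t = g \<cdot> prod_map E s t" for f g
  proof (rule jointly_epicD[OF jointly_epic_times_Ident[OF S B]])
    fix x assume "x \<in> (\<lambda>s. prod_map E s (Ident E B)) ` S"
    then obtain s where s [simp]: "s \<in> S" and x: "x = prod_map E s (Ident E B)" by blast
    have "Dom E s \<in> Obj E" by simp
    show "f \<cdot> x = g \<cdot> x"
    proof (rule jointly_epicD[OF jointly_epic_Ident_times[OF T \<open>Dom E s \<in> Obj E\<close>]])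
      fix y assume "y \<in> prod_map E (Ident E (Dom E s)) ` T"
      then obtain t where t [simp]: "t \<in> T" and y: "y = prod_map E (Ident E (Dom E s)) t" by blast
      show "(f \<cdot> x) \<cdot> y = (g \<cdot> x) \<cdot> y"
        using eq[OF s t] by (simp add: x y)
    qed (simp_all add: x)
  qed simp_all
  show ?thesis
  proof (rule jointly_epicI, goal_cases)
    case 2 then show ?case by auto
  next
    case 3 show ?case by (rule *) (use 3 in blast)+
  qed simp
qed

end

section \<open>The canonical structure of a local state classifier\<close>

locale ccc_with_local_state_classifier = cartesian_closed_category E
  for E :: "('o, 'm, 'z) fp_category_scheme" (structure) +
  fixes \<Xi> :: 'o and \<xi> :: "'o \<Rightarrow> 'm"
  assumes classifier: "local_state_classifier E \<Xi> \<xi>"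
begin

section \<open>The colimit cocone\<close>

lemma mono_cocone_xi: "mono_cocone E \<Xi> \<xi>"
  using classifier unfolding local_state_classifier_def by (rule conjunct1)

lemma Xi_Obj [simp]: "\<Xi> \<in> Obj E"
  using mono_cocone_xi by (simp add: mono_cocone_def)

lemma xi_simps [simp]:
  assumes "X \<in> Obj E"
  shows "\<xi> X \<in> Mor E" "Dom E (\<xi> X) = X" "Cod E (\<xi> X) = \<Xi>"
  using mono_cocone_xi assms by (auto simp: mono_cocone_def Hom_def)

lemma xi_mono: "mono_in E f \<Longrightarrow> \<xi> (Cod E f) \<cdot> f = \<xi> (Dom E f)"
  using mono_cocone_xi by (auto simp: mono_cocone_def)

lemma xi_split_mono:
  assumes "f \<in> Mor E" "r \<in> Mor E" "Dom E r = Cod E f" "r \<cdot> f = Ident E (Dom E f)"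
    "Cod E f = Y" "Dom E f = X"
  shows "\<xi> Y \<cdot> f = \<xi> X"
  using xi_mono[OF split_mono[OF assms(1-4)]] assms by simp

lemma classifier_ex1:
  "mono_cocone E L \<phi> \<Longrightarrow> \<exists>!u. u \<in> Hom E \<Xi> L \<and> (\<forall>X \<in> Obj E. u \<cdot> \<xi> X = \<phi> X)"
  using classifier unfolding local_state_classifier_def by blast

text \<open>The composites of \<open>g\<close> with the cocone form a cocone again, and
  \<open>f\<close> and \<open>g\<close> both mediate it, so uniqueness in the colimit property
  identifies them.\<close>

lemma jointly_epic_xi: "jointly_epic \<Xi> (\<xi> ` Obj E)"
proof -
  have *: "f = g" if fg [simp]: "f \<in> Mor E" "g \<in> Mor E" "Dom E f = \<Xi>" "Dom E g = \<Xi>"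
    "Cod E f = Cod E g" and eq: "\<And>X. X \<in> Obj E \<Longrightarrow> f \<cdot> \<xi> X = g \<cdot> \<xi> X" for f g
  proof -
    have "mono_cocone E (Cod E g) (\<lambda>X. g \<cdot> \<xi> X)"
      unfolding mono_cocone_def
    proof (intro conjI ballI allI impI)
      fix m assume "mono_in E m"
      then show "(g \<cdot> \<xi> (Cod E m)) \<cdot> m = g \<cdot> \<xi> (Dom E m)"
        by (simp add: xi_mono mono_in_Mor)
    qed (simp_all add: Hom_def)
    moreover have "f \<in> Hom E \<Xi> (Cod E g)" "g \<in> Hom E \<Xi> (Cod E g)"
      by (simp_all add: Hom_def)
    ultimately show "f = g"
      using classifier_ex1 eq by blast
  qed
  show ?thesis
  proof (rule jointly_epicI, goal_cases)
    case 2 then show ?case by auto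
  next
    case 3 show ?case by (rule *) (use 3 in blast)+
  qed simp
qed

section \<open>Extension of invariant families along products\<close>

text \<open>This is the existence half of the fact that \<open>- \<times> Y\<close> preserves the
  colimit. The transposes of the \<open>\<phi> X\<close> form a cocone, whose mediating morphism is
  transposed back.\<close>

lemma extend_along_xi_times:
  assumes [simp]: "Y \<in> Obj E" "L \<in> Obj E"
    and \<phi>: "\<And>X. X \<in> Obj E \<Longrightarrow> \<phi> X \<in> Hom E (Prod E X Y) L"
    and inv: "\<And>m. mono_in E m \<Longrightarrow> \<phi> (Cod E m) \<cdot> prod_map E m (Ident E Y) = \<phi> (Dom E m)"
  shows "\<exists>u \<in> Hom E (Prod E \<Xi> Y) L. \<forall>X \<in> Obj E. u \<cdot> prod_map E (\<xi> X) (Ident E Y) = \<phi> X"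
proof -
  have \<phi>' [simp]: "\<phi> X \<in> Mor E" "Dom E (\<phi> X) = Prod E X Y" "Cod E (\<phi> X) = L"
    if "X \<in> Obj E" for X
    using \<phi>[OF that] by (auto simp: Hom_def)
  obtain P ev where ev [simp]: "P \<in> Obj E" "ev \<in> Mor E" "Dom E ev = Prod E P Y" "Cod E ev = L"
    and curry: "\<forall>X \<in> Obj E. bij_betw (\<lambda>h. ev \<cdot> prod_map E h (Ident E Y))
      (Hom E X P) (Hom E (Prod E X Y) L)"
    by (rule exponential[OF assms(1,2)])
  \<comment> \<open>\<open>c X\<close> is the transpose of \<open>\<phi> X\<close>.\<close>
  define c where "c X = inv_into (Hom E X P) (\<lambda>h. ev \<cdot> prod_map E h (Ident E Y)) (\<phi> X)" for X
  have \<phi>_image: "\<phi> X \<in> (\<lambda>h. ev \<cdot> prod_map E h (Ident E Y)) ` Hom E X P" if X: "X \<in> Obj E" for X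
    unfolding bij_betw_imp_surj_on[OF curry[rule_format, OF X]] by (rule \<phi>[OF X])
  have c: "c X \<in> Hom E X P" "ev \<cdot> prod_map E (c X) (Ident E Y) = \<phi> X" if "X \<in> Obj E" for X
    unfolding c_def by (rule inv_into_into[OF \<phi>_image[OF that]])
      (rule f_inv_into_f[OF \<phi>_image[OF that]])
  have c' [simp]: "c X \<in> Mor E" "Dom E (c X) = X" "Cod E (c X) = P" if "X \<in> Obj E" for X
    using c(1)[OF that] by (auto simp: Hom_def)
  have "c (Cod E m) \<cdot> m = c (Dom E m)" if m: "mono_in E m" for m
  proof -
    have [simp]: "m \<in> Mor E" by (rule mono_in_Mor[OF m])
    \<comment> \<open>The cocone equation is checked after evaluation, where it becomes the
      hypothesis \<open>inv\<close>.\<close>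
    have "ev \<cdot> prod_map E (c (Cod E m) \<cdot> m) (Ident E Y)
      = (ev \<cdot> prod_map E (c (Cod E m)) (Ident E Y)) \<cdot> prod_map E m (Ident E Y)"
      by simp
    also have "\<dots> = ev \<cdot> prod_map E (c (Dom E m)) (Ident E Y)"
      by (simp only: c(2) inv[OF m] Obj_simps \<open>m \<in> Mor E\<close>)
    finally show ?thesis
      by (rule inj_onD[OF bij_betw_imp_inj_on[OF
            curry[rule_format, OF Dom_closed[OF \<open>m \<in> Mor E\<close>]]]]) (simp_all add: Hom_def)
  qed
  then have "mono_cocone E P c"
    using c by (auto simp: mono_cocone_def)
  then obtain u where u: "u \<in> Hom E \<Xi> P" "\<And>X. X \<in> Obj E \<Longrightarrow> u \<cdot> \<xi> X = c X"
    using classifier_ex1 by blast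
  have [simp]: "u \<in> Mor E" "Dom E u = \<Xi>" "Cod E u = P" using u(1) by (auto simp: Hom_def)
  show ?thesis
    by (rule bexI[of _ "ev \<cdot> prod_map E u (Ident E Y)"]) (auto simp: u c Hom_def)
qed

text \<open>The family \<open>\<phi> X \<cdot> swap X Y\<close> is extended with the factors
  exchanged, and the result is composed with the symmetry.\<close>

lemma extend_along_times_xi:
  assumes [simp]: "Y \<in> Obj E" "L \<in> Obj E"
    and \<phi>: "\<And>X. X \<in> Obj E \<Longrightarrow> \<phi> X \<in> Hom E (Prod E Y X) L"
    and inv: "\<And>m. mono_in E m \<Longrightarrow> \<phi> (Cod E m) \<cdot> prod_map E (Ident E Y) m = \<phi> (Dom E m)"
  shows "\<exists>u \<in> Hom E (Prod E Y \<Xi>) L. \<forall>X \<in> Obj E. u \<cdot> prod_map E (Ident E Y) (\<xi> X) = \<phi> X"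
proof -
  have \<phi>' [simp]: "\<phi> X \<in> Mor E" "Dom E (\<phi> X) = Prod E Y X" "Cod E (\<phi> X) = L"
    if "X \<in> Obj E" for X
    using \<phi>[OF that] by (auto simp: Hom_def)
  have "\<exists>u \<in> Hom E (Prod E \<Xi> Y) L. \<forall>X \<in> Obj E.
    u \<cdot> prod_map E (\<xi> X) (Ident E Y) = \<phi> X \<cdot> swap X Y"
  proof (rule extend_along_xi_times)
    fix m assume m: "mono_in E m"
    then have [simp]: "m \<in> Mor E" by (rule mono_in_Mor)
    have "(\<phi> (Cod E m) \<cdot> swap (Cod E m) Y) \<cdot> prod_map E m (Ident E Y)
      = (\<phi> (Cod E m) \<cdot> prod_map E (Ident E Y) m) \<cdot> swap (Dom E m) Y"
      by (simp add: swap_prod_map)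
    then show "(\<phi> (Cod E m) \<cdot> swap (Cod E m) Y) \<cdot> prod_map E m (Ident E Y)
      = \<phi> (Dom E m) \<cdot> swap (Dom E m) Y"
      by (simp only: inv[OF m])
  qed (auto simp: Hom_def)
  then obtain u where u: "u \<in> Hom E (Prod E \<Xi> Y) L"
    "\<And>X. X \<in> Obj E \<Longrightarrow> u \<cdot> prod_map E (\<xi> X) (Ident E Y) = \<phi> X \<cdot> swap X Y"
    by blast
  have [simp]: "u \<in> Mor E" "Dom E u = Prod E \<Xi> Y" "Cod E u = L" using u by (auto simp: Hom_def)
  have "(u \<cdot> swap Y \<Xi>) \<cdot> prod_map E (Ident E Y) (\<xi> X) = \<phi> X" if [simp]: "X \<in> Obj E" for X
  proof -
    have "(u \<cdot> swap Y \<Xi>) \<cdot> prod_map E (Ident E Y) (\<xi> X)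
      = (u \<cdot> prod_map E (\<xi> X) (Ident E Y)) \<cdot> swap Y X"
      by (simp add: swap_prod_map)
    then show ?thesis by (simp add: u(2))
  qed
  then show ?thesis
    by (intro bexI[of _ "u \<cdot> swap Y \<Xi>"]) (auto simp: Hom_def)
qed

text \<open>The two variables are extended one at a time: for fixed \<open>Y\<close> the family
  \<open>\<xi> (Prod E X Y)\<close> extends in \<open>X\<close> to a morphism \<open>u Y\<close>,
  and then the family \<open>u\<close> extends in \<open>Y\<close>.\<close>

lemma ex_meet:
  "\<exists>m \<in> Hom E (Prod E \<Xi> \<Xi>) \<Xi>. \<forall>X \<in> Obj E. \<forall>Y \<in> Obj E.
    m \<cdot> prod_map E (\<xi> X) (\<xi> Y) = \<xi> (Prod E X Y)"
proof -
  have "\<forall>Y \<in> Obj E. \<exists>u \<in> Hom E (Prod E \<Xi> Y) \<Xi>. \<forall>X \<in> Obj E.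
    u \<cdot> prod_map E (\<xi> X) (Ident E Y) = \<xi> (Prod E X Y)"
  proof
    fix Y assume Y [simp]: "Y \<in> Obj E"
    show "\<exists>u \<in> Hom E (Prod E \<Xi> Y) \<Xi>. \<forall>X \<in> Obj E.
      u \<cdot> prod_map E (\<xi> X) (Ident E Y) = \<xi> (Prod E X Y)"
    proof (rule extend_along_xi_times)
      fix m assume m: "mono_in E m"
      then show "\<xi> (Prod E (Cod E m) Y) \<cdot> prod_map E m (Ident E Y) = \<xi> (Prod E (Dom E m) Y)"
        using xi_mono[OF mono_prod_map[OF m mono_Ident[OF Y]]] by (simp add: mono_in_Mor)
    qed (simp_all add: Hom_def)
  qed
  then obtain u where u: "\<And>Y. Y \<in> Obj E \<Longrightarrow> u Y \<in> Hom E (Prod E \<Xi> Y) \<Xi>"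
    "\<And>X Y. X \<in> Obj E \<Longrightarrow> Y \<in> Obj E \<Longrightarrow>
      u Y \<cdot> prod_map E (\<xi> X) (Ident E Y) = \<xi> (Prod E X Y)"
    by metis
  have u' [simp]: "u Y \<in> Mor E" "Dom E (u Y) = Prod E \<Xi> Y" "Cod E (u Y) = \<Xi>"
    if "Y \<in> Obj E" for Y
    using u(1)[OF that] by (auto simp: Hom_def)
  have "\<exists>m \<in> Hom E (Prod E \<Xi> \<Xi>) \<Xi>. \<forall>Y \<in> Obj E. m \<cdot> prod_map E (Ident E \<Xi>) (\<xi> Y) = u Y"
  proof (rule extend_along_times_xi)
    fix b assume b: "mono_in E b"
    then have [simp]: "b \<in> Mor E" by (rule mono_in_Mor)
    have [simp]: "Dom E b \<in> Obj E" by simp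
    show "u (Cod E b) \<cdot> prod_map E (Ident E \<Xi>) b = u (Dom E b)"
    \<comment> \<open>\<open>u\<close> is known only through its composites with
      \<open>\<xi> X \<times> id\<close>; there invariance under \<open>b\<close> becomes invariance
      of \<open>\<xi>\<close> under the monomorphism \<open>id \<times> b\<close>.\<close>
    proof (rule jointly_epicD[OF jointly_epic_times_Ident[OF jointly_epic_xi \<open>Dom E b \<in> Obj E\<close>]])
      fix t assume "t \<in> (\<lambda>s. prod_map E s (Ident E (Dom E b))) ` \<xi> ` Obj E"
      then obtain X where X [simp]: "X \<in> Obj E" and t: "t = prod_map E (\<xi> X) (Ident E (Dom E b))"
        by blast
      have "(u (Cod E b) \<cdot> prod_map E (Ident E \<Xi>) b) \<cdot> t
        = (u (Cod E b) \<cdot> prod_map E (\<xi> X) (Ident E (Cod E b))) \<cdot> prod_map E (Ident E X) b"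
        by (simp add: t)
      also have "\<dots> = \<xi> (Prod E X (Dom E b))"
        using xi_mono[OF mono_prod_map[OF mono_Ident[OF X] b]] by (simp add: u(2))
      also have "\<dots> = u (Dom E b) \<cdot> t" by (simp add: t u(2))
      finally show "(u (Cod E b) \<cdot> prod_map E (Ident E \<Xi>) b) \<cdot> t = u (Dom E b) \<cdot> t" .
    qed simp_all
  qed (simp_all add: Hom_def)
  then obtain m where m: "m \<in> Hom E (Prod E \<Xi> \<Xi>) \<Xi>"
    "\<And>Y. Y \<in> Obj E \<Longrightarrow> m \<cdot> prod_map E (Ident E \<Xi>) (\<xi> Y) = u Y"
    by blast
  have [simp]: "m \<in> Mor E" "Dom E m = Prod E \<Xi> \<Xi>" "Cod E m = \<Xi>" using m by (auto simp: Hom_def)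
  have "m \<cdot> prod_map E (\<xi> X) (\<xi> Y) = \<xi> (Prod E X Y)" if [simp]: "X \<in> Obj E" "Y \<in> Obj E" for X Y
  proof -
    have "m \<cdot> prod_map E (\<xi> X) (\<xi> Y)
      = (m \<cdot> prod_map E (Ident E \<Xi>) (\<xi> Y)) \<cdot> prod_map E (\<xi> X) (Ident E Y)"
      by simp
    also have "\<dots> = \<xi> (Prod E X Y)" by (simp only: m u that)
    finally show ?thesis .
  qed
  with m show ?thesis by blast
qed

section \<open>The binary meet and the semilattice laws\<close>

text \<open>The choice is immaterial, because the products \<open>\<xi> X \<times> \<xi> Y\<close>
  are jointly epic.\<close>

definition meet :: 'm where
  "meet = (SOME m. m \<in> Hom E (Prod E \<Xi> \<Xi>) \<Xi> \<and>
    (\<forall>X \<in> Obj E. \<forall>Y \<in> Obj E. m \<cdot> prod_map E (\<xi> X) (\<xi> Y) = \<xi> (Prod E X Y)))"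

lemma meet_spec:
  "meet \<in> Hom E (Prod E \<Xi> \<Xi>) \<Xi> \<and>
    (\<forall>X \<in> Obj E. \<forall>Y \<in> Obj E. meet \<cdot> prod_map E (\<xi> X) (\<xi> Y) = \<xi> (Prod E X Y))"
  unfolding meet_def by (rule someI_ex) (use ex_meet in blast)

lemma meet_simps [simp]:
  "meet \<in> Mor E" "Dom E meet = Prod E \<Xi> \<Xi>" "Cod E meet = \<Xi>"
  using meet_spec by (auto simp: Hom_def)

lemma meet_prod_map [simp]:
  "X \<in> Obj E \<Longrightarrow> Y \<in> Obj E \<Longrightarrow> meet \<cdot> prod_map E (\<xi> X) (\<xi> Y) = \<xi> (Prod E X Y)"
  using meet_spec by blast

text \<open>This is the defining equation of \<open>meet\<close> on generalized elements
  \<open>a\<close> and \<open>b\<close>, the form in which the laws use it.\<close>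

lemma meet_pairing:
  assumes [simp]: "X \<in> Obj E" "Y \<in> Obj E" "a \<in> Mor E" "b \<in> Mor E" "Cod E a = X" "Cod E b = Y"
    "Dom E a = Dom E b"
  shows "meet \<cdot> pairing E (\<xi> X \<cdot> a) (\<xi> Y \<cdot> b) = \<xi> (Prod E X Y) \<cdot> pairing E a b"
proof -
  have "meet \<cdot> pairing E (\<xi> X \<cdot> a) (\<xi> Y \<cdot> b) = (meet \<cdot> prod_map E (\<xi> X) (\<xi> Y)) \<cdot> pairing E a b"
    by (simp del: meet_prod_map)
  then show ?thesis by simp
qed

text \<open>Tested on \<open>(\<xi> X \<times> \<xi> Y) \<times> \<xi> Z\<close>, the two sides
  differ by the reassociation of the triple product, and \<open>\<xi>\<close> is invariant under
  it.\<close>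

lemma meet_assoc:
  "meet \<cdot> prod_map E meet (Ident E \<Xi>) = meet \<cdot> (prod_map E (Ident E \<Xi>) meet \<cdot>
    pairing E (Proj1 E \<Xi> \<Xi> \<cdot> Proj1 E (Prod E \<Xi> \<Xi>) \<Xi>)
      (pairing E (Proj2 E \<Xi> \<Xi> \<cdot> Proj1 E (Prod E \<Xi> \<Xi>) \<Xi>) (Proj2 E (Prod E \<Xi> \<Xi>) \<Xi>)))"
    (is "?l = ?r")
proof (rule jointly_epicD[OF jointly_epic_prod[OF
        jointly_epic_prod[OF jointly_epic_xi jointly_epic_xi] jointly_epic_xi]])
  fix w assume "w \<in> {prod_map E s t |s t.
    s \<in> {prod_map E s t |s t. s \<in> \<xi> ` Obj E \<and> t \<in> \<xi> ` Obj E} \<and> t \<in> \<xi> ` Obj E}"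
  then obtain X Y Z where XYZ [simp]: "X \<in> Obj E" "Y \<in> Obj E" "Z \<in> Obj E"
    and w: "w = prod_map E (prod_map E (\<xi> X) (\<xi> Y)) (\<xi> Z)" by blast
  let ?p = "Proj1 E (Prod E X Y) Z" and ?z = "Proj2 E (Prod E X Y) Z"
  let ?x = "Proj1 E X Y \<cdot> ?p" and ?y = "Proj2 E X Y \<cdot> ?p"
  let ?a = "pairing E ?x (pairing E ?y ?z)"
  have "?l \<cdot> w = \<xi> (Prod E (Prod E X Y) Z)"
    by (simp add: w)
  moreover have "?r \<cdot> w = \<xi> (Prod E X (Prod E Y Z)) \<cdot> ?a"
    by (simp add: w prod_map_def meet_pairing)
  moreover have "\<xi> (Prod E X (Prod E Y Z)) \<cdot> ?a = \<xi> (Prod E (Prod E X Y) Z)"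
    \<comment> \<open>The retraction is the reassociation in the opposite direction.\<close>
    by (rule xi_split_mono[where r = "pairing E (pairing E (Proj1 E X (Prod E Y Z))
          (Proj1 E Y Z \<cdot> Proj2 E X (Prod E Y Z))) (Proj2 E Y Z \<cdot> Proj2 E X (Prod E Y Z))"])
      simp_all
  ultimately show "?l \<cdot> w = ?r \<cdot> w" by simp
qed simp_all

lemma meet_commute: "meet \<cdot> pairing E (Proj2 E \<Xi> \<Xi>) (Proj1 E \<Xi> \<Xi>) = meet"
proof (rule jointly_epicD[OF jointly_epic_prod[OF jointly_epic_xi jointly_epic_xi]])
  fix w assume "w \<in> {prod_map E s t |s t. s \<in> \<xi> ` Obj E \<and> t \<in> \<xi> ` Obj E}"
  then obtain X Y where XY [simp]: "X \<in> Obj E" "Y \<in> Obj E"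
    and w: "w = prod_map E (\<xi> X) (\<xi> Y)" by blast
  have "(meet \<cdot> pairing E (Proj2 E \<Xi> \<Xi>) (Proj1 E \<Xi> \<Xi>)) \<cdot> w = \<xi> (Prod E Y X) \<cdot> swap X Y"
    by (simp add: w prod_map_def meet_pairing swap_def)
  also have "\<dots> = \<xi> (Prod E X Y)"
    by (rule xi_split_mono[where r = "swap Y X"]) simp_all
  finally show "(meet \<cdot> pairing E (Proj2 E \<Xi> \<Xi>) (Proj1 E \<Xi> \<Xi>)) \<cdot> w = meet \<cdot> w"
    by (simp add: w)
qed simp_all

text \<open>The hypothesis lets \<open>f\<close> be replaced by \<open>g\<close> along
  \<open>\<xi> X\<close>, and the graph of \<open>g\<close> is split by the first projection.
  Idempotence, the unit law and the final inequality are all instances.\<close>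

lemma meet_pairing_Ident:
  assumes [simp]: "f \<in> Mor E" "Dom E f = \<Xi>" "Cod E f = \<Xi>"
    and f: "\<And>X. X \<in> Obj E \<Longrightarrow>
      \<exists>Y \<in> Obj E. \<exists>g \<in> Mor E. Dom E g = X \<and> Cod E g = Y \<and> f \<cdot> \<xi> X = \<xi> Y \<cdot> g"
  shows "meet \<cdot> pairing E (Ident E \<Xi>) f = Ident E \<Xi>"
proof (rule jointly_epicD[OF jointly_epic_xi])
  fix w assume "w \<in> \<xi> ` Obj E"
  then obtain X where X [simp]: "X \<in> Obj E" and w: "w = \<xi> X" by blast
  obtain Y g where Y [simp]: "Y \<in> Obj E" "g \<in> Mor E" "Dom E g = X" "Cod E g = Y"
    and g: "f \<cdot> \<xi> X = \<xi> Y \<cdot> g" using f[OF X] by blast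
  have "(meet \<cdot> pairing E (Ident E \<Xi>) f) \<cdot> w = meet \<cdot> pairing E (\<xi> X \<cdot> Ident E X) (\<xi> Y \<cdot> g)"
    by (simp add: w g)
  also have "\<dots> = \<xi> (Prod E X Y) \<cdot> pairing E (Ident E X) g"
    by (rule meet_pairing) simp_all
  also have "\<dots> = \<xi> X"
    by (rule xi_split_mono[where r = "Proj1 E X Y"]) simp_all
  finally show "(meet \<cdot> pairing E (Ident E \<Xi>) f) \<cdot> w = Ident E \<Xi> \<cdot> w"
    by (simp add: w)
qed simp_all

lemma internal_meet_semilattice_meet: "internal_meet_semilattice E \<Xi> (\<xi> (One E)) meet"
proof -
  have "meet \<cdot> pairing E (Ident E \<Xi>) (Ident E \<Xi>) = Ident E \<Xi>"
  proof (rule meet_pairing_Ident)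
    fix X assume "X \<in> Obj E"
    then show "\<exists>Y \<in> Obj E. \<exists>g \<in> Mor E. Dom E g = X \<and> Cod E g = Y \<and> Ident E \<Xi> \<cdot> \<xi> X = \<xi> Y \<cdot> g"
      by (intro bexI[of _ X] bexI[of _ "Ident E X"]) simp_all
  qed simp_all
  moreover have "meet \<cdot> pairing E (Ident E \<Xi>) (\<xi> (One E) \<cdot> bang E \<Xi>) = Ident E \<Xi>"
  proof (rule meet_pairing_Ident)
    fix X assume "X \<in> Obj E"
    then show "\<exists>Y \<in> Obj E. \<exists>g \<in> Mor E. Dom E g = X \<and> Cod E g = Y \<and>
        (\<xi> (One E) \<cdot> bang E \<Xi>) \<cdot> \<xi> X = \<xi> Y \<cdot> g"
      by (intro bexI[of _ "One E"] bexI[of _ "bang E X"]) simp_all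
  qed simp_all
  ultimately show ?thesis
    using meet_assoc meet_commute
    by (simp add: internal_meet_semilattice_def Let_def Hom_def)
qed

section \<open>Finite meets and uniqueness of the canonical structure\<close>

lemma list_prod_Obj [simp]: "set Xs \<subseteq> Obj E \<Longrightarrow> list_prod E Xs \<in> Obj E"
  by (induction Xs) auto

lemma list_prod_map_simps [simp]:
  assumes "set Xs \<subseteq> Obj E"
  shows "list_prod_map E (map \<xi> Xs) \<in> Mor E"
    "Dom E (list_prod_map E (map \<xi> Xs)) = list_prod E Xs"
    "Cod E (list_prod_map E (map \<xi> Xs)) = list_prod E (replicate (length Xs) \<Xi>)"
  using assms by (induction Xs) auto

lemma nary_meet_simps [simp]:
  "nary_meet E \<Xi> (\<xi> (One E)) meet n \<in> Mor E"
  "Dom E (nary_meet E \<Xi> (\<xi> (One E)) meet n) = list_prod E (replicate n \<Xi>)"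
  "Cod E (nary_meet E \<Xi> (\<xi> (One E)) meet n) = \<Xi>"
  by (induction n) simp_all

text \<open>Lists end in the terminal object, so the top must be \<open>\<xi> (One E)\<close>; each
  further entry is one use of the binary equation for \<open>meet\<close>.\<close>

lemma is_canonical_structure_meet: "is_canonical_structure E \<Xi> \<xi> (\<xi> (One E), meet)"
proof -
  have "nary_meet E \<Xi> (\<xi> (One E)) meet (length Xs) \<cdot> list_prod_map E (map \<xi> Xs) =
        \<xi> (list_prod E Xs)" if "set Xs \<subseteq> Obj E" for Xs
    using that by (induction Xs) simp_all
  then show ?thesis
    using internal_meet_semilattice_meet by (simp add: is_canonical_structure_def)
qed

text \<open>The top is read off from the empty list and the meet from a list of length two, after
  cancelling the terminal factor at its end by the unit law.\<close>

lemma canonical_structure_unique: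
  assumes "is_canonical_structure E \<Xi> \<xi> (t, m)"
  shows "t = \<xi> (One E)" "m = meet"
proof -
  have [simp]: "t \<in> Mor E" "Dom E t = One E" "Cod E t = \<Xi>"
    "m \<in> Mor E" "Dom E m = Prod E \<Xi> \<Xi>" "Cod E m = \<Xi>"
    and unit: "m \<cdot> pairing E (Ident E \<Xi>) (t \<cdot> bang E \<Xi>) = Ident E \<Xi>"
    and nary: "\<And>Xs. set Xs \<subseteq> Obj E \<Longrightarrow>
      nary_meet E \<Xi> t m (length Xs) \<cdot> list_prod_map E (map \<xi> Xs) = \<xi> (list_prod E Xs)"
    using assms
    by (auto simp: is_canonical_structure_def internal_meet_semilattice_def Let_def Hom_def)
  show t: "t = \<xi> (One E)" using nary[of "[]"] by simp
  show "m = meet"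
  proof (rule jointly_epicD[OF jointly_epic_prod[OF jointly_epic_xi jointly_epic_xi]])
    fix w assume "w \<in> {prod_map E s t |s t. s \<in> \<xi> ` Obj E \<and> t \<in> \<xi> ` Obj E}"
    then obtain X Y where XY [simp]: "X \<in> Obj E" "Y \<in> Obj E"
      and w: "w = prod_map E (\<xi> X) (\<xi> Y)" by blast
    \<comment> \<open>This is the unit law on generalized elements, obtained by precomposing with
      \<open>a\<close>.\<close>
    have *: "m \<cdot> pairing E a (t \<cdot> bang E (Dom E a)) = a" if [simp]: "a \<in> Mor E" "Cod E a = \<Xi>" for a
    proof -
      have "m \<cdot> pairing E a (t \<cdot> bang E (Dom E a)) =
        (m \<cdot> pairing E (Ident E \<Xi>) (t \<cdot> bang E \<Xi>)) \<cdot> a"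
        by simp
      then show ?thesis using unit by simp
    qed
    let ?p = "Proj1 E X Y" and ?q = "Proj2 E X Y"
    \<comment> \<open>\<open>?i\<close> is the canonical morphism from \<open>X \<times> Y\<close>
      to \<open>X \<times> (Y \<times> 1)\<close>, the product of the list
      \<open>[X, Y]\<close>.\<close>
    let ?i = "pairing E ?p (pairing E ?q (bang E (Prod E X Y)))"
    have "nary_meet E \<Xi> t m (length [X, Y]) \<cdot> list_prod_map E (map \<xi> [X, Y]) \<cdot> ?i
      = m \<cdot> pairing E (\<xi> X \<cdot> ?p) (m \<cdot> pairing E (\<xi> Y \<cdot> ?q) (t \<cdot> bang E (Dom E (\<xi> Y \<cdot> ?q))))"
      by simp
    also have "\<dots> = m \<cdot> w"
      by (subst *) (simp_all add: w prod_map_def)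
    finally have "m \<cdot> w = nary_meet E \<Xi> t m (length [X, Y]) \<cdot> list_prod_map E (map \<xi> [X, Y]) \<cdot> ?i"
      by (rule sym)
    also have "nary_meet E \<Xi> t m (length [X, Y]) \<cdot> list_prod_map E (map \<xi> [X, Y]) =
        \<xi> (list_prod E [X, Y])"
      by (rule nary) simp
    also have "\<xi> (list_prod E [X, Y]) \<cdot> ?i = \<xi> (Prod E X Y)"
      \<comment> \<open>The retraction of \<open>?i\<close> forgets the terminal factor.\<close>
      by (rule xi_split_mono[where r = "pairing E (Proj1 E X (Prod E Y (One E)))
          (Proj1 E Y (One E) \<cdot> Proj2 E X (Prod E Y (One E)))"]) simp_all
    finally show "m \<cdot> w = meet \<cdot> w" by (simp add: w)
  qed simp_all
qed

text \<open>Existence and uniqueness give the definite description its value, so the order on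
  hom-sets can be computed with \<open>meet\<close>.\<close>

lemma canonical_structure_eq: "canonical_structure E \<Xi> \<xi> = (\<xi> (One E), meet)"
  unfolding canonical_structure_def
  by (rule the_equality, rule is_canonical_structure_meet) (auto dest: canonical_structure_unique)

section \<open>Comparison of the identity with normalization\<close>

lemma Ident_le_normalization: "hom_le E \<Xi> \<xi> (Ident E \<Xi>) (\<xi> \<Xi>)"
proof -
  have "meet \<cdot> pairing E (Ident E \<Xi>) (\<xi> \<Xi>) = Ident E \<Xi>"
  proof (rule meet_pairing_Ident)
    fix X assume "X \<in> Obj E"
    then show "\<exists>Y \<in> Obj E. \<exists>g \<in> Mor E. Dom E g = X \<and> Cod E g = Y \<and> \<xi> \<Xi> \<cdot> \<xi> X = \<xi> Y \<cdot> g"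
      \<comment> \<open>The factorization is a tautology: \<open>\<xi> X\<close> itself is a
        morphism into the object \<open>\<Xi>\<close>, so it serves as \<open>g\<close>.\<close>
      by (intro bexI[of _ \<Xi>] bexI[of _ "\<xi> X"]) simp_all
  qed simp_all
  then show ?thesis
    by (simp add: hom_le_def hom_meet_def canonical_structure_eq)
qed

end

theorem proposition4p9:
  fixes E :: "('o, 'm, 'z) fp_category_scheme"
    and \<Xi> :: 'o
    and \<xi> :: "'o \<Rightarrow> 'm"
  assumes "cartesian_closed_category E"
    and "local_state_classifier E \<Xi> \<xi>"
  shows "hom_le E \<Xi> \<xi> (Ident E \<Xi>) (\<xi> \<Xi>)"
proof -
  interpret ccc_with_local_state_classifier E \<Xi> \<xi>
    using assms by (intro ccc_with_local_state_classifier.intro)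
      (simp_all add: ccc_with_local_state_classifier_axioms_def)
  show ?thesis by (rule Ident_le_normalization)
qed

end
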